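(* Suppose $F$ satisfies Assumption A1 and $F\in MDA(H_\xi)$ with $\xi>0$. For a threshold $a$ set $\beta=\bar F(a)$, $\eta=f(a)$, $\nu=-f'(a)$. Fix $x$ with $1-\frac{1}{2(\xi+1)}<x\le1$ and let $p=p(a)$ satisfy $1-p=x\beta$. Let $q=F^{-1}(p)$ be the true $p$-quantile and $q^*$ the optimal value of $$\sup_{q'\ge a,\,g}\ q'\ \text{ s.t. }(1-\beta)+\int_a^{q'}g=p,\ \int_a^\infty g=\beta,\ g(a)=g(a+)=\eta,\ g'_+(a)\ge-\nu,\ g\text{ convex and }\ge0\text{ on }[a,\infty).$$ Then $$\lim_{a\to\infty}\frac{q^*}{q}=x^\xi\left[\frac{\xi}{\xi+1}\left(1-\sqrt{1-2(1-x)(\xi+1)}\right)+1\right].$$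
   Context: $X$ is a continuous random variable with distribution function $F$, density $f$, $\bar F=1-F$, right endpoint $x_F=\sup\{x:F(x)<1\}$. $H_\xi(x)=\exp\{-(1+\xi x)^{-1/\xi}\}$ for $\xi\neq0$. $F\in MDA(H_\xi)$ means there exist $c_n>0$, $d_n$ with $c_n^{-1}(M_n-d_n)$ converging in distribution to $H_\xi$, $M_n$ the maximum of $n$ i.i.d. copies of $X$. Assumption A1: there exists $z<x_F$ such that on $(z,x_F)$, $F$ is twice differentiable and $f$ is positive, decreasing and convex. $g(a+)$ is the right limit and $g'_+$ the right derivative. *)

theory Defs
  imports "HOL-Analysis.Analysis" "HOL-Library.Extended_Real"
begin

text \<open>Generalized extreme value d.f. H_xi, extended by its limiting values
  outside the support {x. 1 + xi x > 0}.\<close>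
definition GEV :: "real \<Rightarrow> real \<Rightarrow> real" where
  "GEV xi t = (if 1 + xi * t > 0 then exp (- ((1 + xi * t) powr (- 1 / xi)))
               else if xi > 0 then 0 else 1)"

definition cdf_with_density :: "(real \<Rightarrow> real) \<Rightarrow> (real \<Rightarrow> real) \<Rightarrow> bool" where
  "cdf_with_density F f \<longleftrightarrow> mono F \<and> (F \<longlongrightarrow> 0) at_bot \<and> (F \<longlongrightarrow> 1) at_top
     \<and> (\<forall>t. f t \<ge> 0) \<and> (\<forall>t. (f has_integral F t) {..t})"

definition right_endpoint :: "(real \<Rightarrow> real) \<Rightarrow> ereal" where
  "right_endpoint F = (SUP x \<in> {x. F x < 1}. ereal x)"

text \<open>Maximum domain of attraction: P(M_n <= c_n t + d_n) = F(c_n t + d_n)^n -> H_xi(t)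
  (H_xi is continuous, so convergence at every t).\<close>
definition MDA :: "(real \<Rightarrow> real) \<Rightarrow> real \<Rightarrow> bool" where
  "MDA F xi \<longleftrightarrow> (\<exists>c d :: nat \<Rightarrow> real. (\<forall>n. c n > 0) \<and>
      (\<forall>t. (\<lambda>n. F (c n * t + d n) ^ n) \<longlonglongrightarrow> GEV xi t))"

definition assumption_A1 :: "(real \<Rightarrow> real) \<Rightarrow> (real \<Rightarrow> real) \<Rightarrow> bool" where
  "assumption_A1 F f \<longleftrightarrow> (\<exists>z. ereal z < right_endpoint F \<and>
     (let I = {y. z < y \<and> ereal y < right_endpoint F} in
       (\<forall>y\<in>I. (F has_real_derivative f y) (at y) \<and> f differentiable (at y) \<and> f y > 0)
       \<and> (\<forall>u\<in>I. \<forall>v\<in>I. u \<le> v \<longrightarrow> f v \<le> f u)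
       \<and> convex_on I f))"

definition quantile :: "(real \<Rightarrow> real) \<Rightarrow> real \<Rightarrow> real" where
  "quantile F p = Inf {y. p \<le> F y}"

definition feasible :: "real \<Rightarrow> real \<Rightarrow> real \<Rightarrow> real \<Rightarrow> real \<Rightarrow> real \<Rightarrow> (real \<Rightarrow> real) \<Rightarrow> bool" where
  "feasible a beta eta nu p q' g \<longleftrightarrow> q' \<ge> a
     \<and> (g has_integral (p - (1 - beta))) {a..q'}
     \<and> (g has_integral beta) {a..}
     \<and> g a = eta \<and> (g \<longlongrightarrow> eta) (at_right a)
     \<and> (\<exists>D. (g has_real_derivative D) (at_right a) \<and> D \<ge> - nu)
     \<and> convex_on {a..} g \<and> (\<forall>y\<ge>a. g y \<ge> 0)"

definition qstar :: "real \<Rightarrow> real \<Rightarrow> real \<Rightarrow> real \<Rightarrow> real \<Rightarrow> ereal" where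
  "qstar a beta eta nu p = Sup {ereal q' | q'. \<exists>g. feasible a beta eta nu p q' g}"

end

(*
  Writing alpha = 1/xi and G = 1 - F, MDA membership says n G(c_n s + d_n) -> s^(-alpha) for s > 0
  after an affine change of the normalisation.  Comparing the indices n and n div 2 gives
  c_(n div 2) / c_n -> 2^(-xi) < 1 and d_(n div 2) - d_n = o(c_n), so d_n = o(c_n), and G is
  regularly varying with index -alpha.  Inverting this limit gives q/a -> x^(-xi).  The monotone
  density theorem, applied first to G and f and then to f and -f', yields a eta / beta -> alpha and
  a nu / eta -> alpha + 1.  In the optimisation problem, g lies above its tangent line at a, so the
  mass (1 - x) beta is collected most slowly by following this line; the optimum is
  q* = a + (eta - sqrt (eta^2 - 2 nu (1 - x) beta)) / nu, attained because the limits above force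
  eta^2 <= 2 nu beta and 2 nu (1 - x) beta < eta^2 for large a.
*)
theory Submission
  imports Defs
begin

section \<open>Halving recursions and limits of monotone functions\<close>

text \<open>Each halving of the index shrinks the excess of \<open>r\<close> over a small level
  \<open>\<delta>\<close> by the factor \<open>\<theta>\<close>. For
  \<open>n \<ge> 2 ^ j * N\<close> the recursion applies \<open>j\<close> times in a row, which
  leaves an excess of at most \<open>\<theta> ^ j * M\<close>.\<close>

lemma halving_recursion_tendsto_zero:
  fixes r e :: "nat \<Rightarrow> real"
  assumes "0 \<le> \<theta>" "\<theta> < 1" and r: "\<And>n. 0 \<le> r n"
    and rec: "\<forall>\<^sub>F n in sequentially. r n \<le> \<theta> * r (n div 2) + e n"
    and e: "e \<longlonglongrightarrow> 0"
  shows "r \<longlonglongrightarrow> 0"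
proof (rule tendstoI)
  fix \<epsilon> :: real assume "\<epsilon> > 0"
  \<comment> \<open>Once \<open>e\<close> is below \<open>(1 - \<theta>) * \<delta>\<close>, the
    level \<open>\<delta>\<close> is the fixed point of the bounding recursion; the other half of
    \<open>\<epsilon>\<close> absorbs the geometric term.\<close>
  define \<delta> where "\<delta> = \<epsilon> / 2"
  have \<delta>: "\<delta> > 0" using \<open>\<epsilon> > 0\<close> by (simp add: \<delta>_def)
  have "\<forall>\<^sub>F n in sequentially. e n < (1 - \<theta>) * \<delta>"
    using order_tendstoD(2)[OF e] \<delta> assms(2) by simp
  with rec have "\<forall>\<^sub>F n in sequentially. r n \<le> \<theta> * r (n div 2) + (1 - \<theta>) * \<delta>"
    by eventually_elim linarith
  then obtain N0 where "\<forall>n\<ge>N0. r n \<le> \<theta> * r (n div 2) + (1 - \<theta>) * \<delta>"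
    unfolding eventually_sequentially by blast
  \<comment> \<open>A positive \<open>N\<close> ensures \<open>n div 2 < n\<close> for
    \<open>n \<ge> N\<close>, as the strong induction below requires.\<close>
  moreover define N where "N = Suc N0"
  ultimately have N: "r n \<le> \<theta> * r (n div 2) + (1 - \<theta>) * \<delta>" if "n \<ge> N" for n
    using that by simp
  define M where "M = Max (r ` {..N})"
  have M: "r n \<le> M" if "n \<le> N" for n
    unfolding M_def using that by (intro Max_ge) auto
  have M0: "M \<ge> 0" using M[of 0] r[of 0] by simp
  have bound: "r n \<le> \<delta> + \<theta> ^ j * M" if "n \<ge> 2 ^ j * N" for n j
    using that
  proof (induction j arbitrary: n)
    case 0
    have "r n \<le> \<delta> + M" for n
    proof (induction n rule: less_induct)
      case (less n)
      show ?case
      proof (cases "n \<ge> N")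
        case False
        then show ?thesis using M[of n] \<delta> by simp
      next
        case True
        then have "n div 2 < n" by (simp add: N_def)
        have "r n \<le> \<theta> * r (n div 2) + (1 - \<theta>) * \<delta>" using N True .
        also have "\<dots> \<le> \<theta> * (\<delta> + M) + (1 - \<theta>) * \<delta>"
          using less[OF \<open>n div 2 < n\<close>] assms(1) by (simp add: mult_left_mono)
        also have "\<dots> = \<delta> + \<theta> * M" by algebra
        also have "\<dots> \<le> \<delta> + M" using assms(2) M0 by (simp add: mult_left_le_one_le assms(1))
        finally show ?thesis .
      qed
    qed
    then show ?case by simp
  next
    case (Suc j)
    have 1: "N \<le> 2 ^ Suc j * N" by simp
    have 2: "n div 2 \<ge> 2 ^ j * N" using Suc.prems by (simp add: less_eq_div_iff_mult_less_eq mult_ac)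
    have "r n \<le> \<theta> * r (n div 2) + (1 - \<theta>) * \<delta>" using N 1 Suc.prems le_trans by blast
    also have "\<dots> \<le> \<theta> * (\<delta> + \<theta> ^ j * M) + (1 - \<theta>) * \<delta>"
      using Suc.IH[OF 2] assms(1) by (simp add: mult_left_mono)
    also have "\<dots> = \<delta> + \<theta> ^ Suc j * M" by (simp add: algebra_simps)
    finally show ?case .
  qed
  have "(\<lambda>j. \<theta> ^ j * M) \<longlonglongrightarrow> 0 * M"
    using assms(1,2) by (intro tendsto_intros LIMSEQ_power_zero) auto
  then have "\<forall>\<^sub>F j in sequentially. \<theta> ^ j * M < \<delta>"
    using order_tendstoD(2) \<delta> by fastforce
  then obtain j where j: "\<theta> ^ j * M < \<delta>" by (auto simp: eventually_sequentially)
  have "dist (r n) 0 < \<epsilon>" if "n \<ge> 2 ^ j * N" for n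
    using bound[OF that] j r[of n] by (simp add: \<delta>_def)
  then show "\<forall>\<^sub>F n in sequentially. dist (r n) 0 < \<epsilon>"
    unfolding eventually_sequentially by blast
qed

text \<open>Antitonicity turns pointwise convergence into convergence along moving arguments: by
  continuity of the power function, the limit at some fixed \<open>t\<close> near \<open>s\<close>
  is already on the right side of \<open>l\<close>, and \<open>\<sigma> i\<close> eventually lies on
  the favourable side of \<open>t\<close>.\<close>

lemma antimono_powr_limit_compose:
  fixes h :: "'i \<Rightarrow> real \<Rightarrow> real"
  assumes anti: "\<forall>\<^sub>F i in \<F>. antimono (h i)"
    and lim: "\<And>s. s > 0 \<Longrightarrow> ((\<lambda>i. h i s) \<longlongrightarrow> s powr (- \<alpha>)) \<F>"
    and \<sigma>: "(\<sigma> \<longlongrightarrow> s) \<F>" and s: "s > 0"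
  shows "((\<lambda>i. h i (\<sigma> i)) \<longlongrightarrow> s powr (- \<alpha>)) \<F>"
proof (rule order_tendstoI)
  have cont: "((\<lambda>t. t powr (- \<alpha>)) \<longlongrightarrow> s powr (- \<alpha>)) (at s)"
    using s by (intro tendsto_intros) auto
  fix l assume "l < s powr (- \<alpha>)"
  then have "\<forall>\<^sub>F t in at_right s. l < t powr (- \<alpha>)"
    using order_tendstoD(1)[OF cont] filter_leD[OF at_le[of "{s<..}" UNIV]] by auto
  moreover have "\<forall>\<^sub>F t in at_right s. s < t" by (simp add: eventually_at_right_less)
  ultimately have "\<forall>\<^sub>F t in at_right s. s < t \<and> l < t powr (- \<alpha>)" by eventually_elim auto
  then obtain t where t: "s < t" "l < t powr (- \<alpha>)"
    using eventually_happens'[OF trivial_limit_at_right_real] by blast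
  have "\<forall>\<^sub>F i in \<F>. l < h i t" using order_tendstoD(1)[OF lim] t s by simp
  moreover have "\<forall>\<^sub>F i in \<F>. \<sigma> i < t" using order_tendstoD(2)[OF \<sigma>] t by simp
  ultimately show "\<forall>\<^sub>F i in \<F>. l < h i (\<sigma> i)"
  using anti
  proof eventually_elim
    case (elim i)
    then show ?case using antimonoD[of "h i" "\<sigma> i" t] by simp
  qed
next
  have cont: "((\<lambda>t. t powr (- \<alpha>)) \<longlongrightarrow> s powr (- \<alpha>)) (at s)"
    using s by (intro tendsto_intros) auto
  fix l assume "l > s powr (- \<alpha>)"
  then have "\<forall>\<^sub>F t in at_left s. l > t powr (- \<alpha>)"
    using order_tendstoD(2)[OF cont] filter_leD[OF at_le[of "{..<s}" UNIV]] by auto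
  moreover have "\<forall>\<^sub>F t in at_left s. t \<in> {0<..<s}" using s eventually_at_left_real by blast
  ultimately have "\<forall>\<^sub>F t in at_left s. (0 < t \<and> t < s) \<and> t powr (- \<alpha>) < l" 
    by eventually_elim auto
  then obtain t where t: "0 < t" "t < s" "l > t powr (- \<alpha>)"
    using eventually_happens'[OF trivial_limit_at_left_real] by blast
  have "\<forall>\<^sub>F i in \<F>. h i t < l" using order_tendstoD(2)[OF lim] t s by simp
  moreover have "\<forall>\<^sub>F i in \<F>. t < \<sigma> i" using order_tendstoD(1)[OF \<sigma>] t by simp
  ultimately show "\<forall>\<^sub>F i in \<F>. h i (\<sigma> i) < l"
  using anti
  proof eventually_elim
    case (elim i)
    then show ?case using antimonoD[of "h i" t "\<sigma> i"] by simp
  qed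
qed

text \<open>Strict decrease of the power function leaves room for a value \<open>m\<close> between
  its values at \<open>s\<close> and at a competing point. If \<open>\<sigma> i\<close> were beyond
  that point, antitonicity would put \<open>h i (\<sigma> i)\<close> on the wrong side of
  \<open>m\<close>.\<close>

lemma antimono_powr_limit_inverse:
  fixes h :: "'i \<Rightarrow> real \<Rightarrow> real"
  assumes anti: "\<forall>\<^sub>F i in \<F>. antimono (h i)"
    and lim: "\<And>s. s > 0 \<Longrightarrow> ((\<lambda>i. h i s) \<longlongrightarrow> s powr (- \<alpha>)) \<F>"
    and \<sigma>: "((\<lambda>i. h i (\<sigma> i)) \<longlongrightarrow> s powr (- \<alpha>)) \<F>" and s: "s > 0" and \<alpha>: "\<alpha> > 0"
  shows "(\<sigma> \<longlongrightarrow> s) \<F>"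
proof (rule order_tendstoI)
  fix l assume l: "l < s"
  \<comment> \<open>The limit of \<open>h i t\<close> is given for positive \<open>t\<close>, hence
    the cut at 0.\<close>
  define t where "t = (max l 0 + s) / 2"
  have t: "l < t" "t < s" "0 < t" using l s by (auto simp: t_def)
  then have less: "s powr (- \<alpha>) < t powr (- \<alpha>)" using \<alpha> by (intro powr_less_mono2_neg) auto
  then obtain m where m: "s powr (- \<alpha>) < m" "m < t powr (- \<alpha>)" using dense by blast
  have "\<forall>\<^sub>F i in \<F>. h i (\<sigma> i) < m" using order_tendstoD(2)[OF \<sigma>] m by simp
  moreover have "\<forall>\<^sub>F i in \<F>. m < h i t" using order_tendstoD(1)[OF lim] m t by simp
  ultimately show "\<forall>\<^sub>F i in \<F>. l < \<sigma> i"
  using anti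
  proof eventually_elim
    case (elim i)
    then show ?case using antimonoD[of "h i" "\<sigma> i" t] t by linarith
  qed
next
  fix l assume l: "l > s"
  have less: "l powr (- \<alpha>) < s powr (- \<alpha>)" using l s \<alpha> by (intro powr_less_mono2_neg) auto
  then obtain m where m: "l powr (- \<alpha>) < m" "m < s powr (- \<alpha>)" using dense by blast
  have "\<forall>\<^sub>F i in \<F>. h i (\<sigma> i) > m" using order_tendstoD(1)[OF \<sigma>] m by simp
  moreover have "\<forall>\<^sub>F i in \<F>. m > h i l" using order_tendstoD(2)[OF lim] m l s by simp
  ultimately show "\<forall>\<^sub>F i in \<F>. l > \<sigma> i"
  using anti
  proof eventually_elim
    case (elim i)
    then show ?case using antimonoD[of "h i" l "\<sigma> i"] by linarith
  qed
qed

section \<open>From convergence of maxima to tail asymptotics\<close>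

text \<open>Logarithms give that \<open>n * ln (u n)\<close> tends to \<open>- L\<close>, which
  forces \<open>u n\<close> to 1. The bounds \<open>u * (- ln u) \<le> 1 - u \<le> - ln u\<close>
  then let \<open>1 - u n\<close> replace \<open>- ln (u n)\<close>.\<close>

lemma power_limit_imp_tail_limit:
  fixes u :: "nat \<Rightarrow> real"
  assumes u: "\<And>n. 0 \<le> u n" "\<And>n. u n \<le> 1"
    and lim: "(\<lambda>n. u n ^ n) \<longlonglongrightarrow> exp (- L)"
  shows "(\<lambda>n. real n * (1 - u n)) \<longlonglongrightarrow> L"
proof -
  have "\<forall>\<^sub>F n in sequentially. 0 < u n ^ n" using order_tendstoD(1)[OF lim] by simp
  with eventually_gt_at_top[of 0] have pos: "\<forall>\<^sub>F n in sequentially. n > 0 \<and> 0 < u n"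
    by eventually_elim (metis u(1) order_le_less power_eq_0_iff)
  have "(\<lambda>n. ln (u n ^ n)) \<longlonglongrightarrow> ln (exp (- L))" by (intro tendsto_ln lim) simp
  then have "(\<lambda>n. ln (u n ^ n)) \<longlonglongrightarrow> - L" by simp
  moreover have "\<forall>\<^sub>F n in sequentially. ln (u n ^ n) = real n * ln (u n)"
    using pos by eventually_elim (simp add: ln_realpow)
  ultimately have ln: "(\<lambda>n. real n * ln (u n)) \<longlonglongrightarrow> - L"
    by (rule Lim_transform_eventually)
  have "(\<lambda>n. real n * ln (u n) * (1 / real n)) \<longlonglongrightarrow> - L * 0"
    by (intro tendsto_mult ln lim_const_over_n)
  moreover have "\<forall>\<^sub>F n in sequentially. real n * ln (u n) * (1 / real n) = ln (u n)"
    using pos by eventually_elim simp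
  ultimately have "(\<lambda>n. ln (u n)) \<longlonglongrightarrow> - L * 0" by (rule Lim_transform_eventually)
  then have "(\<lambda>n. exp (ln (u n))) \<longlonglongrightarrow> exp (- L * 0)" by (intro tendsto_exp)
  moreover have "\<forall>\<^sub>F n in sequentially. exp (ln (u n)) = u n" using pos by eventually_elim simp
  ultimately have "u \<longlonglongrightarrow> exp (- L * 0)" by (rule Lim_transform_eventually)
  then have u1: "u \<longlonglongrightarrow> 1" by simp
  show ?thesis
  proof (rule tendsto_sandwich)
    show "(\<lambda>n. u n * - (real n * ln (u n))) \<longlonglongrightarrow> L" using tendsto_mult[OF u1 tendsto_minus[OF ln]] by simp
    show "(\<lambda>n. - (real n * ln (u n))) \<longlonglongrightarrow> L" using tendsto_minus[OF ln] by simp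
    show "\<forall>\<^sub>F n in sequentially. real n * (1 - u n) \<le> - (real n * ln (u n))"
      using pos
    proof eventually_elim
      case (elim n)
      then have "1 - u n \<le> - ln (u n)" using ln_le_minus_one[of "u n"] by simp
      then have "real n * (1 - u n) \<le> real n * (- ln (u n))" by (intro mult_left_mono) auto
      then show ?case by simp
    qed
    show "\<forall>\<^sub>F n in sequentially. u n * - (real n * ln (u n)) \<le> real n * (1 - u n)"
      using pos
    proof eventually_elim
      case (elim n)
      then have "ln (inverse (u n)) \<le> inverse (u n) - 1" by (intro ln_le_minus_one) auto
      then have "- ln (u n) \<le> inverse (u n) - 1" using elim by (simp add: ln_inverse)
      then have "u n * - ln (u n) \<le> u n * (inverse (u n) - 1)" using elim by (intro mult_left_mono) auto
      also have "\<dots> = 1 - u n" using elim by (simp add: algebra_simps)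
      finally have "real n * (u n * - ln (u n)) \<le> real n * (1 - u n)" by (intro mult_left_mono) auto
      then show ?case by (simp add: algebra_simps)
    qed
  qed
qed

lemma cdf_bounds:
  assumes "cdf_with_density F f"
  shows "0 \<le> F y" "F y \<le> 1"
proof -
  have m: "mono F" and 0: "(F \<longlongrightarrow> 0) at_bot" and 1: "(F \<longlongrightarrow> 1) at_top"
    using assms by (auto simp: cdf_with_density_def)
  have "\<forall>\<^sub>F t in at_bot. F t \<le> F y" using eventually_le_at_bot[of y]
    by eventually_elim (rule monoD[OF m])
  then show "0 \<le> F y" using tendsto_upperbound[OF 0] by simp
  have "\<forall>\<^sub>F t in at_top. F y \<le> F t" using eventually_ge_at_top[of y]
    by eventually_elim (rule monoD[OF m])
  then show "F y \<le> 1" using tendsto_lowerbound[OF 1] by simp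
qed

text \<open>The substitution \<open>s = 1 + xi * t\<close>, absorbed into the constants, turns the
  GEV law into the Frechet law, whose exponent is a pure power of \<open>s\<close>.\<close>

lemma MDA_imp_tail_limit:
  assumes F: "cdf_with_density F f" and "MDA F xi" "xi > 0"
  obtains c d :: "nat \<Rightarrow> real" where "\<And>n. c n > 0"
    "\<And>s. s > 0 \<Longrightarrow> (\<lambda>n. real n * (1 - F (c n * s + d n))) \<longlonglongrightarrow> s powr (- (1 / xi))"
proof -
  obtain c d where c: "\<And>n. c n > 0" and lim: "\<And>t. (\<lambda>n. F (c n * t + d n) ^ n) \<longlonglongrightarrow> GEV xi t"
    using assms(2) unfolding MDA_def by auto
  show ?thesis
  proof (rule that[of "\<lambda>n. c n / xi" "\<lambda>n. d n - c n / xi"])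
    show "c n / xi > 0" for n using c assms(3) by simp
    fix s :: real assume s: "s > 0"
    have eq: "c n / xi * s + (d n - c n / xi) = c n * ((s - 1) / xi) + d n" for n
      using assms(3) by (simp add: field_simps)
    have "1 + xi * ((s - 1) / xi) = s" using assms(3) by simp
    then have "GEV xi ((s - 1) / xi) = exp (- (s powr (- (1 / xi))))"
      using s by (simp add: GEV_def)
    with lim[of "(s - 1) / xi"]
    show "(\<lambda>n. real n * (1 - F (c n / xi * s + (d n - c n / xi)))) \<longlonglongrightarrow> s powr (- (1 / xi))"
      unfolding eq by (intro power_limit_imp_tail_limit cdf_bounds[OF F]) simp
  qed
qed

section \<open>Normalising constants and regular variation of the tail\<close>

lemma antimono_scaled_affine:
  fixes G :: "real \<Rightarrow> real"
  assumes G: "antimono G" and "0 \<le> k" "0 \<le> c"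
  shows "antimono (\<lambda>s. k * G (c * s + d))"
proof (rule antimonoI)
  fix s t :: real assume "s \<le> t"
  then have "c * s + d \<le> c * t + d" using assms by (simp add: mult_left_mono)
  then show "k * G (c * t + d) \<le> k * G (c * s + d)"
    using antimonoD[OF G] assms by (intro mult_left_mono) auto
qed

text \<open>A convergence of types argument for the indices \<open>n\<close> and
  \<open>n div 2\<close>. Replacing the factor \<open>n div 2\<close> by \<open>n\<close> doubles
  the limit, and \<open>2 * s powr (- \<alpha>)\<close> is the power function at
  \<open>2 powr (- (1 / \<alpha>)) * s\<close>. By asymptotic inversion the two affine
  normalisations differ in the limit by this scaling alone.\<close>

lemma halving_normalisation:
  fixes G :: "real \<Rightarrow> real" and c d :: "nat \<Rightarrow> real"
  assumes G: "antimono G" and c: "\<And>n. c n > 0" and \<alpha>: "\<alpha> > 0"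
    and lim: "\<And>s. s > 0 \<Longrightarrow> (\<lambda>n. real n * G (c n * s + d n)) \<longlonglongrightarrow> s powr (- \<alpha>)"
  shows "(\<lambda>n. c (n div 2) / c n) \<longlonglongrightarrow> 2 powr (- (1 / \<alpha>))"
    and "(\<lambda>n. (d (n div 2) - d n) / c n) \<longlonglongrightarrow> 0"
proof -
  define m :: "nat \<Rightarrow> nat" where "m n = n div 2" for n
  have m: "filterlim m at_top sequentially"
    unfolding filterlim_at_top eventually_sequentially m_def
  proof
    fix Z :: nat
    show "\<exists>N. \<forall>n\<ge>N. Z \<le> n div 2" by (intro exI[of _ "2 * Z"]) auto
  qed
  have lim2: "(\<lambda>n. real n * G (c (m n) * s + d (m n))) \<longlonglongrightarrow> (2 powr (- (1 / \<alpha>)) * s) powr (- \<alpha>)"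
    if s: "s > 0" for s
  proof -
    let ?g = "\<lambda>n. G (c n * s + d n)"
    have 1: "(\<lambda>n. real (m n) * ?g (m n)) \<longlonglongrightarrow> s powr (- \<alpha>)"
      using filterlim_compose[OF lim[OF s] m] .
    have "(\<lambda>n. real n * ?g n * (1 / real n)) \<longlonglongrightarrow> s powr (- \<alpha>) * 0"
      by (intro tendsto_mult lim s lim_const_over_n)
    moreover have "\<forall>\<^sub>F n in sequentially. real n * ?g n * (1 / real n) = ?g n"
      using eventually_gt_at_top[of 0] by eventually_elim simp
    ultimately have "?g \<longlonglongrightarrow> s powr (- \<alpha>) * 0" by (rule Lim_transform_eventually)
    then have "?g \<longlonglongrightarrow> 0" by simp
    then have "(\<lambda>n. ?g (m n)) \<longlonglongrightarrow> 0" by (rule filterlim_compose[OF _ m])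
    then have abs: "(\<lambda>n. \<bar>?g (m n)\<bar>) \<longlonglongrightarrow> 0" by (rule tendsto_rabs_zero)
    \<comment> \<open>The parity remainder in \<open>n = 2 * m n + n mod 2\<close> adds at most one
      value of \<open>G\<close>, which tends to 0.\<close>
    have "norm (real (n mod 2) * ?g (m n)) \<le> \<bar>?g (m n)\<bar>" for n
    proof -
      have "real (n mod 2) * \<bar>?g (m n)\<bar> \<le> 1 * \<bar>?g (m n)\<bar>" by (intro mult_right_mono) auto
      then show ?thesis by (simp add: abs_mult)
    qed
    then have 2: "(\<lambda>n. real (n mod 2) * ?g (m n)) \<longlonglongrightarrow> 0"
      by (intro Lim_null_comparison[OF always_eventually abs] allI)
    have n: "real n = 2 * real (m n) + real (n mod 2)" for n
      unfolding m_def by (metis mult_div_mod_eq of_nat_add of_nat_mult of_nat_numeral)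
    have "(\<lambda>n. 2 * (real (m n) * ?g (m n)) + real (n mod 2) * ?g (m n)) \<longlonglongrightarrow> 2 * s powr (- \<alpha>) + 0"
      by (rule tendsto_add[OF tendsto_mult_left[OF 1] 2])
    moreover have "2 * (real (m n) * ?g (m n)) + real (n mod 2) * ?g (m n) = real n * ?g (m n)" for n
      by (simp add: n[of n] algebra_simps)
    moreover have "(2 powr (- (1 / \<alpha>)) * s) powr (- \<alpha>) = 2 * s powr (- \<alpha>)"
      using s \<alpha> by (simp add: powr_mult powr_powr)
    ultimately show ?thesis by simp
  qed
  \<comment> \<open>The point normalised at the index \<open>m n\<close>, read in the coordinates of
    the index \<open>n\<close>. It is affine in \<open>s\<close>, so its values at 1 and 2 recover
    slope and intercept.\<close>
  define \<sigma> where "\<sigma> s n = (c (m n) * s + d (m n) - d n) / c n" for s n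
  have \<sigma>: "\<sigma> s \<longlonglongrightarrow> 2 powr (- (1 / \<alpha>)) * s" if s: "s > 0" for s
  proof (rule antimono_powr_limit_inverse[where h = "\<lambda>n s. real n * G (c n * s + d n)" and \<alpha> = \<alpha>])
    show "\<forall>\<^sub>F n in sequentially. antimono (\<lambda>s. real n * G (c n * s + d n))"
      using antimono_scaled_affine[OF G] c by (simp add: less_imp_le)
    have "c n * \<sigma> s n + d n = c (m n) * s + d (m n)" for n
      using c[of n] by (simp add: \<sigma>_def)
    then show "(\<lambda>n. real n * G (c n * \<sigma> s n + d n)) \<longlonglongrightarrow> (2 powr (- (1 / \<alpha>)) * s) powr (- \<alpha>)"
      using lim2[OF s] by simp
  qed (use s \<alpha> in \<open>simp_all add: lim\<close>)
  have "(\<lambda>n. \<sigma> 2 n - \<sigma> 1 n) \<longlonglongrightarrow> 2 powr (- (1 / \<alpha>)) * 2 - 2 powr (- (1 / \<alpha>)) * 1"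
    by (intro tendsto_diff \<sigma>) auto
  moreover have "\<sigma> 2 n - \<sigma> 1 n = c (n div 2) / c n" for n
    using c[of n] by (simp add: \<sigma>_def m_def field_simps)
  ultimately show "(\<lambda>n. c (n div 2) / c n) \<longlonglongrightarrow> 2 powr (- (1 / \<alpha>))" by simp
  have "(\<lambda>n. 2 * \<sigma> 1 n - \<sigma> 2 n) \<longlonglongrightarrow> 2 * (2 powr (- (1 / \<alpha>)) * 1) - 2 powr (- (1 / \<alpha>)) * 2"
    by (intro tendsto_intros \<sigma>) auto
  moreover have "2 * \<sigma> 1 n - \<sigma> 2 n = (d (n div 2) - d n) / c n" for n
    using c[of n] by (simp add: \<sigma>_def m_def field_simps)
  ultimately show "(\<lambda>n. (d (n div 2) - d n) / c n) \<longlonglongrightarrow> 0" by simp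
qed

text \<open>Both \<open>1 / c n\<close> and \<open>\<bar>d n / c n\<bar>\<close> obey halving
  recursions with a factor \<open>\<theta>\<close> strictly between
  \<open>2 powr (- (1 / \<alpha>))\<close> and 1; the errors are 0 and the vanishing intercept from
  \<open>halving_normalisation\<close>.\<close>

lemma normalisation_limits:
  fixes G :: "real \<Rightarrow> real" and c d :: "nat \<Rightarrow> real"
  assumes G: "antimono G" and c: "\<And>n. c n > 0" and \<alpha>: "\<alpha> > 0"
    and lim: "\<And>s. s > 0 \<Longrightarrow> (\<lambda>n. real n * G (c n * s + d n)) \<longlonglongrightarrow> s powr (- \<alpha>)"
  shows "filterlim c at_top sequentially" and "(\<lambda>n. d n / c n) \<longlonglongrightarrow> 0"
proof -
  note half = halving_normalisation[OF G c \<alpha> lim]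
  have "(2::real) powr (- (1 / \<alpha>)) < 1" using \<alpha> by (simp add: powr_less_one)
  then obtain \<theta> :: real where \<theta>: "2 powr (- (1 / \<alpha>)) < \<theta>" "\<theta> < 1" using dense by blast
  then have \<theta>0: "0 \<le> \<theta>" using powr_ge_zero[of 2 "- (1 / \<alpha>)"] by linarith
  have ev: "\<forall>\<^sub>F n in sequentially. c (n div 2) / c n < \<theta>"
    using order_tendstoD(2)[OF half(1)] \<theta> by simp
  have "(\<lambda>n. inverse (c n)) \<longlonglongrightarrow> 0"
  proof (rule halving_recursion_tendsto_zero[OF \<theta>0 \<theta>(2), where e = "\<lambda>_. 0"])
    show "0 \<le> inverse (c n)" for n using c[of n] by simp
    show "\<forall>\<^sub>F n in sequentially. inverse (c n) \<le> \<theta> * inverse (c (n div 2)) + 0"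
      using ev
    proof eventually_elim
      case (elim n)
      have "c (n div 2) / c n * inverse (c (n div 2)) \<le> \<theta> * inverse (c (n div 2))"
        using elim c[of "n div 2"] by (intro mult_right_mono) auto
      then show ?case using c[of "n div 2"] c[of n] by (simp add: field_simps)
    qed
  qed auto
  then have "filterlim (\<lambda>n. inverse (inverse (c n))) at_top sequentially"
    by (rule filterlim_inverse_at_top) (simp add: c)
  then show "filterlim c at_top sequentially" by simp
  have "(\<lambda>n. \<bar>d n / c n\<bar>) \<longlonglongrightarrow> 0"
  proof (rule halving_recursion_tendsto_zero[OF \<theta>0 \<theta>(2), where e = "\<lambda>n. \<bar>(d (n div 2) - d n) / c n\<bar>"])
    show "(\<lambda>n. \<bar>(d (n div 2) - d n) / c n\<bar>) \<longlonglongrightarrow> 0" using half(2) by (rule tendsto_rabs_zero)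
    show "\<forall>\<^sub>F n in sequentially. \<bar>d n / c n\<bar> \<le> \<theta> * \<bar>d (n div 2) / c (n div 2)\<bar> + \<bar>(d (n div 2) - d n) / c n\<bar>"
      using ev
    proof eventually_elim
      case (elim n)
      have "d n / c n = c (n div 2) / c n * (d (n div 2) / c (n div 2)) - (d (n div 2) - d n) / c n"
        using c[of "n div 2"] c[of n] by (simp add: field_simps)
      then have "\<bar>d n / c n\<bar> \<le> \<bar>c (n div 2) / c n * (d (n div 2) / c (n div 2))\<bar> + \<bar>(d (n div 2) - d n) / c n\<bar>"
        by linarith
      also have "\<bar>c (n div 2) / c n * (d (n div 2) / c (n div 2))\<bar> = c (n div 2) / c n * \<bar>d (n div 2) / c (n div 2)\<bar>"
        using c[of "n div 2"] c[of n] by (simp add: abs_mult)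
      also have "\<dots> \<le> \<theta> * \<bar>d (n div 2) / c (n div 2)\<bar>" using elim by (intro mult_right_mono) auto
      finally show ?case by simp
    qed
  qed auto
  then show "(\<lambda>n. d n / c n) \<longlonglongrightarrow> 0" by (rule tendsto_rabs_zero_cancel)
qed

text \<open>An index \<open>N a\<close> with \<open>N a * G a\<close> tending to 1 ties the sequence
  to the continuous variable. By inversion the normalised coordinate of \<open>a\<close> tends to 1;
  as \<open>d\<close> is negligible against \<open>c\<close>, that of \<open>a * t\<close> tends to
  \<open>t\<close>, and the sequential limit passes to \<open>G (a * t) / G a\<close>.\<close>

lemma tail_regularly_varying:
  fixes G :: "real \<Rightarrow> real" and c d :: "nat \<Rightarrow> real"
  assumes G: "antimono G" and G0: "(G \<longlongrightarrow> 0) at_top" and c: "\<And>n. c n > 0" and \<alpha>: "\<alpha> > 0"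
    and lim: "\<And>s. s > 0 \<Longrightarrow> (\<lambda>n. real n * G (c n * s + d n)) \<longlonglongrightarrow> s powr (- \<alpha>)"
  shows "G y > 0" and "t > 0 \<Longrightarrow> ((\<lambda>a. G (a * t) / G a) \<longlongrightarrow> t powr (- \<alpha>)) at_top"
proof -
  note norm = normalisation_limits[OF G c \<alpha> lim]
  \<comment> \<open>The points \<open>c n + d n\<close> run to infinity and \<open>G\<close> is
    eventually positive at them; antitonicity carries this back to \<open>y\<close>.\<close>
  have pos: "G y > 0" for y
  proof -
    have "(\<lambda>n. 1 + d n / c n) \<longlonglongrightarrow> 1 + 0" by (intro tendsto_intros norm)
    then have "filterlim (\<lambda>n. (1 + d n / c n) * c n) at_top sequentially"
      using norm(1) by (intro filterlim_tendsto_pos_mult_at_top[of _ "1 + 0"]) auto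
    then have "\<forall>\<^sub>F n in sequentially. y \<le> (1 + d n / c n) * c n" by (simp add: filterlim_at_top)
    moreover have "\<forall>\<^sub>F n in sequentially. 0 < real n * G (c n * 1 + d n)"
      using order_tendstoD(1)[OF lim[of 1]] by simp
    ultimately have "\<forall>\<^sub>F n in sequentially. 0 < G y"
    proof eventually_elim
      case (elim n)
      have "(1 + d n / c n) * c n = c n * 1 + d n" using c[of n] by (simp add: field_simps)
      with elim(1) have "y \<le> c n * 1 + d n" by simp
      then have "G (c n * 1 + d n) \<le> G y" using G by (rule antimonoD[rotated])
      with elim(2) show ?case by (simp add: zero_less_mult_iff)
    qed
    then show ?thesis by simp
  qed
  then show "G y > 0" .
  define N where "N a = nat \<lfloor>1 / G a\<rfloor>" for a
  have N_le: "real (N a) \<le> 1 / G a" "1 / G a - 1 \<le> real (N a)" for a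
  proof -
    have "real (N a) = of_int \<lfloor>1 / G a\<rfloor>" using pos[of a] by (simp add: N_def)
    then show "real (N a) \<le> 1 / G a" "1 / G a - 1 \<le> real (N a)" by linarith+
  qed
  have "filterlim (\<lambda>a. inverse (G a)) at_top at_top"
    by (rule filterlim_inverse_at_top[OF G0]) (simp add: pos)
  then have "filterlim (\<lambda>a. - 1 + 1 / G a) at_top at_top"
    by (intro filterlim_tendsto_add_at_top[OF tendsto_const]) (simp add: divide_inverse)
  then have "filterlim (\<lambda>a. real (N a)) at_top at_top"
    by (rule filterlim_at_top_mono) (use N_le in auto)
  then have N: "filterlim N sequentially at_top" by (simp add: filterlim_sequentially_iff_filterlim_real)
  have NG: "((\<lambda>a. real (N a) * G a) \<longlongrightarrow> 1) at_top"
  proof (rule tendsto_sandwich)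
    show "((\<lambda>a. 1 - G a) \<longlongrightarrow> 1) at_top" using tendsto_diff[OF tendsto_const G0, of 1] by simp
    show "\<forall>\<^sub>F a in at_top. 1 - G a \<le> real (N a) * G a"
    proof (intro always_eventually allI)
      fix a
      have "(1 / G a - 1) * G a \<le> real (N a) * G a" using N_le pos[of a] by (intro mult_right_mono) auto
      then show "1 - G a \<le> real (N a) * G a" using pos[of a] by (simp add: algebra_simps)
    qed
    show "\<forall>\<^sub>F a in at_top. real (N a) * G a \<le> 1"
      using N_le(1) pos by (simp add: field_simps)
  qed auto
  define h where "h a s = real (N a) * G (c (N a) * s + d (N a))" for a s
  have anti: "\<forall>\<^sub>F a in at_top. antimono (h a)"
    unfolding h_def using antimono_scaled_affine[OF G] c by (simp add: less_imp_le)
  have h: "((\<lambda>a. h a s) \<longlongrightarrow> s powr (- \<alpha>)) at_top" if "s > 0" for s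
    unfolding h_def using filterlim_compose[OF lim[OF that] N] .
  define \<sigma> where "\<sigma> t a = (a * t - d (N a)) / c (N a)" for t a
  have h\<sigma>: "h a (\<sigma> t a) = real (N a) * G (a * t)" for a t
    using c[of "N a"] by (simp add: h_def \<sigma>_def)
  \<comment> \<open>At this coordinate \<open>h a\<close> equals \<open>N a * G a\<close>, whose
    limit 1 is \<open>1 powr (- \<alpha>)\<close>.\<close>
  have \<sigma>1: "(\<sigma> 1 \<longlongrightarrow> 1) at_top"
    by (rule antimono_powr_limit_inverse[OF anti h _ _ \<alpha>]) (use NG in \<open>simp_all add: h\<sigma>\<close>)
  assume t: "t > 0"
  have "((\<lambda>a. t * \<sigma> 1 a + (t - 1) * (d (N a) / c (N a))) \<longlongrightarrow> t * 1 + (t - 1) * 0) at_top"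
    by (rule tendsto_add[OF tendsto_mult_left[OF \<sigma>1] tendsto_mult_left[OF filterlim_compose[OF norm(2) N]]])
  moreover have "t * \<sigma> 1 a + (t - 1) * (d (N a) / c (N a)) = \<sigma> t a" for a
    using c[of "N a"] by (simp add: \<sigma>_def field_simps)
  ultimately have "(\<sigma> t \<longlongrightarrow> t) at_top" by simp
  from antimono_powr_limit_compose[OF anti h this t]
  have "((\<lambda>a. h a (\<sigma> t a)) \<longlongrightarrow> t powr (- \<alpha>)) at_top" by simp
  then have "((\<lambda>a. h a (\<sigma> t a) / (real (N a) * G a)) \<longlongrightarrow> t powr (- \<alpha>) / 1) at_top"
    by (intro tendsto_divide NG) auto
  moreover have "\<forall>\<^sub>F a in at_top. Suc 0 \<le> N a"
    using N by (simp only: filterlim_at_top)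
  then have "\<forall>\<^sub>F a in at_top. h a (\<sigma> t a) / (real (N a) * G a) = G (a * t) / G a"
    by eventually_elim (simp add: h\<sigma>)
  ultimately have "((\<lambda>a. G (a * t) / G a) \<longlongrightarrow> t powr (- \<alpha>) / 1) at_top"
    by (rule Lim_transform_eventually)
  then show "((\<lambda>a. G (a * t) / G a) \<longlongrightarrow> t powr (- \<alpha>)) at_top" by simp
qed

section \<open>Monotone density theorem\<close>

text \<open>The tangent inequality at \<open>a * t\<close> reads
  \<open>1 - U (a * t) / U a \<le> (a * u a / U a) * (t - 1)\<close>. Division by
  \<open>t - 1\<close> bounds \<open>a * u a / U a\<close> from below if \<open>t > 1\<close> and
  from above if \<open>t < 1\<close>; the limits of these bounds approach \<open>\<rho>\<close> as
  \<open>t\<close> tends to 1. Stated by tangents, the result serves the tail with its density and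
  the density with its negated derivative alike.\<close>

lemma monotone_density:
  fixes U u :: "real \<Rightarrow> real"
  assumes tangent: "\<And>a y. z < a \<Longrightarrow> z < y \<Longrightarrow> U a - u a * (y - a) \<le> U y"
    and pos: "\<And>a. z < a \<Longrightarrow> U a > 0"
    and rv: "\<And>t. t > 0 \<Longrightarrow> ((\<lambda>a. U (a * t) / U a) \<longlongrightarrow> t powr (- \<rho>)) at_top"
  shows "((\<lambda>a. a * u a / U a) \<longlongrightarrow> \<rho>) at_top"
proof -
  define \<phi> where "\<phi> t = (1 - t powr (- \<rho>)) / (t - 1)" for t
  \<comment> \<open>\<open>\<phi> t\<close> is the difference quotient of
    \<open>- (t powr (- \<rho>))\<close> at 1.\<close>
  have "((\<lambda>t. - (t powr (- \<rho>))) has_real_derivative \<rho>) (at 1)"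
    by (auto intro!: derivative_eq_intros)
  then have \<phi>: "(\<phi> \<longlongrightarrow> \<rho>) (at 1)"
    by (simp add: has_field_derivative_iff \<phi>_def[abs_def])
  have quot: "((\<lambda>a. (1 - U (a * t) / U a) / (t - 1)) \<longlongrightarrow> \<phi> t) at_top" if "t > 0" "t \<noteq> 1" for t
    unfolding \<phi>_def using that by (intro tendsto_intros rv) auto
  have tan: "1 - U (a * t) / U a \<le> (a * u a / U a) * (t - 1)" if "z < a" "z < a * t" for a t
  proof -
    have "(U a - u a * (a * t - a)) / U a \<le> U (a * t) / U a"
      using tangent[OF that] pos[OF that(1)] by (intro divide_right_mono) auto
    then have "U a / U a - u a * (a * t - a) / U a \<le> U (a * t) / U a" by (simp add: diff_divide_distrib)
    moreover have "u a * (a * t - a) / U a = (a * u a / U a) * (t - 1)" by (simp add: algebra_simps)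
    ultimately show ?thesis using pos[OF that(1)] by simp
  qed
  have large: "\<forall>\<^sub>F a in at_top. z < a \<and> z < a * t" if "t > 0" for t
  proof -
    have "filterlim (\<lambda>a. a * t) at_top at_top" using that
      by (intro filterlim_at_top_mult_tendsto_pos[OF tendsto_const] filterlim_ident) auto
    then have "\<forall>\<^sub>F a in at_top. z < a * t" by (simp add: filterlim_at_top_dense)
    with eventually_gt_at_top[of z] show ?thesis by eventually_elim simp
  qed
  show ?thesis
  proof (rule order_tendstoI)
    fix l assume "l < \<rho>"
    then have "\<forall>\<^sub>F t in at_right 1. l < \<phi> t"
      using order_tendstoD(1)[OF \<phi>] filter_leD[OF at_le[of "{1<..}" UNIV]] by auto
    moreover have "\<forall>\<^sub>F t in at_right 1. (1::real) < t" by (simp add: eventually_at_right_less)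
    ultimately have "\<forall>\<^sub>F t in at_right 1. 1 < t \<and> l < \<phi> t" by eventually_elim auto
    then obtain t where t: "1 < t" "l < \<phi> t"
      using eventually_happens'[OF trivial_limit_at_right_real] by blast
    have "\<forall>\<^sub>F a in at_top. l < (1 - U (a * t) / U a) / (t - 1)"
      using order_tendstoD(1)[OF quot] t by simp
    moreover have "\<forall>\<^sub>F a in at_top. z < a \<and> z < a * t" using large t by simp
    ultimately show "\<forall>\<^sub>F a in at_top. l < a * u a / U a"
    proof eventually_elim
      case (elim a)
      have "(1 - U (a * t) / U a) / (t - 1) \<le> a * u a / U a"
        using tan[of a t] elim t by (subst pos_divide_le_eq) auto
      with elim show ?case by linarith
    qed
  next
    fix l assume "\<rho> < l"
    then have "\<forall>\<^sub>F t in at_left 1. \<phi> t < l"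
      using order_tendstoD(2)[OF \<phi>] filter_leD[OF at_le[of "{..<1}" UNIV]] by auto
    moreover have "\<forall>\<^sub>F t in at_left 1. t \<in> {0::real<..<1}" using eventually_at_left_real[of 0 1] by simp
    ultimately have "\<forall>\<^sub>F t in at_left 1. (0 < t \<and> t < 1) \<and> \<phi> t < l" by eventually_elim auto
    then obtain t where t: "0 < t" "t < 1" "\<phi> t < l"
      using eventually_happens'[OF trivial_limit_at_left_real] by blast
    have "\<forall>\<^sub>F a in at_top. (1 - U (a * t) / U a) / (t - 1) < l"
      using order_tendstoD(2)[OF quot] t by simp
    moreover have "\<forall>\<^sub>F a in at_top. z < a \<and> z < a * t" using large t by simp
    ultimately show "\<forall>\<^sub>F a in at_top. a * u a / U a < l"
    proof eventually_elim
      case (elim a)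
      have "a * u a / U a \<le> (1 - U (a * t) / U a) / (t - 1)"
        using tan[of a t] elim t by (subst neg_le_divide_eq) auto
      with elim show ?case by linarith
    qed
  qed
qed

text \<open>The quotient \<open>u (a * t) / u a\<close> equals \<open>U (a * t) / U a / t\<close>
  times the ratio of the values of \<open>a * u a / U a\<close> at \<open>a * t\<close> and at
  \<open>a\<close>, and this ratio tends to 1 because \<open>\<rho>\<close> is nonzero.\<close>

lemma density_regularly_varying:
  fixes U u :: "real \<Rightarrow> real"
  assumes pos: "\<And>a. z < a \<Longrightarrow> U a > 0"
    and rv: "((\<lambda>a. U (a * t) / U a) \<longlongrightarrow> t powr (- \<rho>)) at_top"
    and lim: "((\<lambda>a. a * u a / U a) \<longlongrightarrow> \<rho>) at_top" and "\<rho> > 0" and t: "t > 0"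
  shows "((\<lambda>a. u (a * t) / u a) \<longlongrightarrow> t powr (- (\<rho> + 1))) at_top"
proof -
  have at: "filterlim (\<lambda>a. a * t) at_top at_top" using t
    by (intro filterlim_at_top_mult_tendsto_pos[OF tendsto_const] filterlim_ident) auto
  have lim': "((\<lambda>a. (a * t * u (a * t) / U (a * t)) / (a * u a / U a) * (U (a * t) / U a) / t)
      \<longlongrightarrow> \<rho> / \<rho> * t powr (- \<rho>) / t) at_top"
    using assms by (intro tendsto_intros filterlim_compose[OF lim at]) auto
  have eq: "\<rho> / \<rho> * t powr (- \<rho>) / t = t powr (- (\<rho> + 1))"
    using assms powr_diff[of t "- \<rho>" 1] by simp
  have "\<forall>\<^sub>F a in at_top. z < a * t" using at by (simp add: filterlim_at_top_dense)
  with eventually_gt_at_top[of 0] eventually_gt_at_top[of z]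
  have "\<forall>\<^sub>F a in at_top. (a * t * u (a * t) / U (a * t)) / (a * u a / U a) * (U (a * t) / U a) / t
      = u (a * t) / u a"
  proof eventually_elim
    case (elim a)
    then have "U a \<noteq> 0" "U (a * t) \<noteq> 0" "a \<noteq> 0" "t \<noteq> 0" using pos[of a] pos[of "a * t"] t by auto
    \<comment> \<open>If \<open>u a\<close> vanishes, both sides are 0 by the convention for
      division by zero.\<close>
    then show ?case by (cases "u a = 0") (simp_all add: field_simps)
  qed
  with lim' show ?thesis unfolding eq by (rule Lim_transform_eventually)
qed

section \<open>The convex optimisation problem\<close>

lemma convex_on_max:
  fixes f g :: "'a::real_vector \<Rightarrow> real"
  assumes "convex_on S f" "convex_on S g"
  shows "convex_on S (\<lambda>x. max (f x) (g x))"
  unfolding convex_on_def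
proof (intro conjI ballI allI impI)
  show "convex S" using assms(1) by (rule convex_on_imp_convex)
  fix x y and u v :: real
  assume *: "x \<in> S" "y \<in> S" "0 \<le> u" "0 \<le> v" "u + v = 1"
  have "f (u *\<^sub>R x + v *\<^sub>R y) \<le> u * f x + v * f y" "g (u *\<^sub>R x + v *\<^sub>R y) \<le> u * g x + v * g y"
    using assms * unfolding convex_on_def by blast+
  moreover have "u * f x \<le> u * max (f x) (g x)" "u * g x \<le> u * max (f x) (g x)"
    "v * f y \<le> v * max (f y) (g y)" "v * g y \<le> v * max (f y) (g y)"
    using * by (auto intro: mult_left_mono)
  ultimately show "max (f (u *\<^sub>R x + v *\<^sub>R y)) (g (u *\<^sub>R x + v *\<^sub>R y))
      \<le> u * max (f x) (g x) + v * max (f y) (g y)" by linarith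
qed

lemma convex_on_affine:
  fixes A B c :: real
  assumes "convex S"
  shows "convex_on S (\<lambda>y. A - B * (y - c))"
  unfolding convex_on_def
proof (intro conjI ballI allI impI assms)
  fix x y u v :: real
  assume "u + v = 1"
  then have v: "v = 1 - u" by simp
  show "A - B * (u *\<^sub>R x + v *\<^sub>R y - c) \<le> u * (A - B * (x - c)) + v * (A - B * (y - c))"
    unfolding v by (simp add: algebra_simps)
qed

lemma has_integral_affine:
  fixes A B a w :: real
  assumes "0 \<le> w"
  shows "((\<lambda>y. A - B * (y - a)) has_integral A * w - B * w\<^sup>2 / 2) {a..a + w}"
proof -
  have "((\<lambda>y. A - B * (y - a)) has_integral
      (A * (a + w) - B * (a + w - a)\<^sup>2 / 2) - (A * a - B * (a - a)\<^sup>2 / 2)) {a..a + w}"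
  proof (rule fundamental_theorem_of_calculus)
    fix y :: real
    show "((\<lambda>y. A * y - B * (y - a)\<^sup>2 / 2) has_vector_derivative A - B * (y - a)) (at y within {a..a + w})"
      unfolding has_real_derivative_iff_has_vector_derivative[symmetric]
      by (auto intro!: derivative_eq_intros)
  qed (use assms in simp)
  then show ?thesis by (simp add: algebra_simps)
qed

text \<open>Slopes of chords from \<open>a\<close> are nondecreasing in the other endpoint, so their
  limit \<open>D\<close> at \<open>a\<close> is at most the slope of the chord to
  \<open>y\<close>.\<close>

lemma convex_on_right_tangent:
  fixes g :: "real \<Rightarrow> real"
  assumes g: "convex_on {a..} g" and D: "(g has_real_derivative D) (at_right a)" and "a < y"
  shows "g a + D * (y - a) \<le> g y"
proof -
  have lim: "((\<lambda>t. (g t - g a) / (t - a)) \<longlongrightarrow> D) (at_right a)"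
    using D by (simp add: has_field_derivative_iff)
  have "\<forall>\<^sub>F t in at_right a. t \<in> {a<..<y}" using \<open>a < y\<close> by (rule eventually_at_right_real)
  then have "\<forall>\<^sub>F t in at_right a. (g t - g a) / (t - a) \<le> (g y - g a) / (y - a)"
  proof eventually_elim
    case (elim t)
    then have "(g a - g t) / (a - t) \<le> (g a - g y) / (a - y)"
      using \<open>a < y\<close> by (intro convex_on_slope_le(1)[OF g]) auto
    then show ?case by (metis minus_diff_eq minus_divide_divide)
  qed
  then have "D \<le> (g y - g a) / (y - a)" using tendsto_upperbound[OF lim] by simp
  then show ?thesis using \<open>a < y\<close> by (simp add: field_simps)
qed

text \<open>The tangent line of slope \<open>- \<nu>\<close> lies below every feasible density, so accumulating
  mass along it is slowest and bounds \<open>q'\<close> from above.\<close>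

lemma feasible_le:
  fixes a \<beta> \<eta> \<nu> p q' :: real
  assumes feas: "feasible a \<beta> \<eta> \<nu> p q' g" and \<nu>: "\<nu> > 0"
    and p: "p - (1 - \<beta>) = \<eta> * u - \<nu> * u\<^sup>2 / 2" and u: "0 \<le> u" "\<nu> * u < \<eta>"
  shows "q' \<le> a + u"
proof (rule ccontr)
  assume "\<not> q' \<le> a + u"
  then have q': "u < q' - a" by simp
  \<comment> \<open>A length beyond \<open>u\<close> that stops at the zero
    \<open>\<eta> / \<nu>\<close> of the tangent line, so that the line carries strictly more mass
    over \<open>w\<close> than over \<open>u\<close>.\<close>
  define w where "w = min (q' - a) (\<eta> / \<nu>)"
  have w: "u < w" "a + w \<le> q'" "\<nu> * w \<le> \<eta>"
    using q' u(2) \<nu> by (auto simp: w_def field_simps min_def)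
  obtain D where D: "(g has_real_derivative D) (at_right a)" "- \<nu> \<le> D"
    using feas by (auto simp: feasible_def)
  have g: "(g has_integral p - (1 - \<beta>)) {a..q'}" "g a = \<eta>" "convex_on {a..} g" "\<And>y. y \<ge> a \<Longrightarrow> 0 \<le> g y"
    using feas by (auto simp: feasible_def)
  have lower: "\<eta> - \<nu> * (y - a) \<le> g y" if "y \<in> {a..a + w}" for y
  proof (cases "y = a")
    case False
    then have "a < y" using that by auto
    have "\<eta> + (- \<nu>) * (y - a) \<le> \<eta> + D * (y - a)" using D(2) \<open>a < y\<close>
      by (intro add_left_mono mult_right_mono) auto
    also have "\<dots> \<le> g y" using convex_on_right_tangent[OF g(3) D(1) \<open>a < y\<close>] g(2) by simp
    finally show ?thesis by simp
  qed (simp add: g)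
  have sub: "{a..a + w} \<subseteq> {a..q'}" using w by auto
  have int: "g integrable_on {a..a + w}"
    using g(1) sub integrable_on_subinterval has_integral_integrable by blast
  have "\<eta> * w - \<nu> * w\<^sup>2 / 2 \<le> integral {a..a + w} g"
    using w u by (intro has_integral_le[OF has_integral_affine integrable_integral[OF int]] lower) auto
  also have "\<dots> \<le> integral {a..q'} g"
    using g by (intro integral_subset_le sub int) (auto simp: has_integral_integrable)
  also have "\<dots> = \<eta> * u - \<nu> * u\<^sup>2 / 2" using g(1) p by (simp add: integral_unique)
  finally have "(w - u) * (\<eta> - \<nu> * (u + w) / 2) \<le> 0" by (simp add: field_simps power2_eq_square)
  moreover have "(w - u) * (\<eta> - \<nu> * (u + w) / 2) > 0"
    using w u by (intro mult_pos_pos) (auto simp: algebra_simps)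
  ultimately show False by simp
qed

text \<open>Follow the tangent line for a length \<open>u\<close> and then place the remaining mass
  under a triangle, whose hypotenuse is flatter than the tangent.\<close>

lemma feasible_piecewise_linear:
  fixes a \<beta> \<eta> \<nu> p u h s :: real
  assumes p: "p - (1 - \<beta>) = \<eta> * u - \<nu> * u\<^sup>2 / 2" and u: "0 \<le> u"
    and h: "h = \<eta> - \<nu> * u" "h > 0" and s: "s > 0" "s \<le> \<nu>" and rest: "1 - p = h\<^sup>2 / (2 * s)"
  shows "feasible a \<beta> \<eta> \<nu> p (a + u)
    (\<lambda>y. max (max (\<eta> - \<nu> * (y - a)) (h - s * (y - (a + u)))) 0)" (is "feasible _ _ _ _ _ _ ?g")
proof -
  define b where "b = a + u"
  \<comment> \<open>The hypotenuse reaches 0 at \<open>e\<close>; the triangle over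
    \<open>{b..e}\<close> has area \<open>1 - p\<close> by \<open>rest\<close>.\<close>
  define e where "e = b + h / s"
  \<comment> \<open>A maximum of affine functions is convex by construction; \<open>g1\<close>,
    \<open>g2\<close> and \<open>g3\<close> recover its three pieces.\<close>
  define g where "g = (\<lambda>y. max (max (\<eta> - \<nu> * (y - a)) (h - s * (y - b))) 0)"
  have be: "b < e" using h s by (simp add: e_def)
  have tangent: "\<eta> - \<nu> * (y - a) = h - \<nu> * (y - b)" for y
    by (simp add: h b_def algebra_simps)
  have g1: "g y = \<eta> - \<nu> * (y - a)" if "y \<le> b" for y
  proof -
    have "s * (b - y) \<le> \<nu> * (b - y)" "0 \<le> s * (b - y)" using that s by (auto intro: mult_right_mono)
    then show ?thesis unfolding g_def tangent using h(2) by (simp add: algebra_simps)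
  qed
  have steep: "h - \<nu> * (y - b) \<le> h - s * (y - b)" if "b \<le> y" for y
    using that s by (simp add: mult_right_mono)
  have g2: "g y = h - s * (y - b)" if "b \<le> y" "y \<le> e" for y
  proof -
    have "s * (y - b) \<le> s * (e - b)" using that s by (intro mult_left_mono) auto
    also have "\<dots> = h" using s by (simp add: e_def)
    finally show ?thesis unfolding g_def tangent using steep[OF that(1)] by simp
  qed
  have g3: "g y = 0" if "e \<le> y" for y
  proof -
    have "h = s * (e - b)" using s by (simp add: e_def)
    also have "\<dots> \<le> s * (y - b)" using that s by (intro mult_left_mono) auto
    finally show ?thesis unfolding g_def tangent using steep[of y] that be by simp
  qed
  have i1: "(g has_integral p - (1 - \<beta>)) {a..b}"
    unfolding p b_def by (rule has_integral_eq[OF _ has_integral_affine[OF u]]) (simp add: g1 b_def)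
  have "h * (h / s) - s * (h / s)\<^sup>2 / 2 = h\<^sup>2 / (2 * s)"
    using s by (simp add: field_simps power2_eq_square)
  moreover have "(g has_integral h * (h / s) - s * (h / s)\<^sup>2 / 2) {b..e}"
    unfolding e_def by (rule has_integral_eq[OF _ has_integral_affine]) (use h s in \<open>auto simp: g2 e_def\<close>)
  ultimately have i2: "(g has_integral 1 - p) {b..e}" using rest by simp
  have "(g has_integral (p - (1 - \<beta>)) + (1 - p)) {a..e}"
    using be u by (intro has_integral_combine[OF _ _ i1 i2]) (auto simp: b_def)
  moreover have "{y \<in> {a..e} - {a..}. g y \<noteq> 0} = {}" "{y \<in> {a..} - {a..e}. g y \<noteq> 0} = {}"
    using g3 by (auto intro: linear[THEN disjE])
  then have "(g has_integral \<beta>) {a..e} \<longleftrightarrow> (g has_integral \<beta>) {a..}"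
    by (intro has_integral_spike_set_eq) (simp_all only: negligible_empty)
  ultimately have i: "(g has_integral \<beta>) {a..}" by simp
  have g_a: "g a = \<eta>" using g1[of a] u by (simp add: b_def)
  have lim: "(g \<longlongrightarrow> g a) (at_right a)"
    unfolding g_def by (intro tendsto_intros)
  \<comment> \<open>If \<open>u = 0\<close>, the tangent segment degenerates and \<open>g\<close>
    starts along the hypotenuse with slope \<open>- s \<ge> - \<nu>\<close>; otherwise it starts
    with slope \<open>- \<nu>\<close>.\<close>
  have "\<exists>D. (g has_real_derivative D) (at a within {a..}) \<and> - \<nu> \<le> D"
  proof (cases "u = 0")
    case True
    have "((\<lambda>y. h - s * (y - b)) has_real_derivative - s) (at a within {a..})"
      by (auto intro!: derivative_eq_intros)
    then have "(g has_real_derivative - s) (at a within {a..})"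
      by (rule has_field_derivative_transform_within[where d = "e - b"])
        (use be True in \<open>auto simp: g2 b_def dist_real_def\<close>)
    with s show ?thesis by auto
  next
    case False
    have "((\<lambda>y. \<eta> - \<nu> * (y - a)) has_real_derivative - \<nu>) (at a within {a..})"
      by (auto intro!: derivative_eq_intros)
    then have "(g has_real_derivative - \<nu>) (at a within {a..})"
      by (rule has_field_derivative_transform_within[where d = u])
        (use False u in \<open>auto simp: g1 b_def dist_real_def\<close>)
    then show ?thesis by auto
  qed
  then obtain D where D: "(g has_real_derivative D) (at a within {a..})" "- \<nu> \<le> D" by blast
  have "(g has_real_derivative D) (at_right a)" by (rule DERIV_subset[OF D(1)]) auto
  with D(2) have deriv: "\<exists>D. (g has_real_derivative D) (at_right a) \<and> - \<nu> \<le> D" by blast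
  have "convex_on {a..} g"
    unfolding g_def by (intro convex_on_max convex_on_affine convex_on_const[THEN iffD2]) simp_all
  moreover have "\<forall>y\<ge>a. 0 \<le> g y" by (simp add: g_def)
  moreover have "(g \<longlongrightarrow> \<eta>) (at_right a)" using lim g_a by simp
  moreover have "a \<le> b" using u by (simp add: b_def)
  ultimately have "feasible a \<beta> \<eta> \<nu> p b g"
    unfolding feasible_def using i1 i g_a deriv by blast
  then show ?thesis by (simp only: g_def b_def)
qed

text \<open>The length \<open>u\<close> over which the tangent line collects the mass
  \<open>(1 - x) * \<beta>\<close> is the smaller root of a quadratic, and \<open>h\<close> is the
  height of the line there. Hypothesis \<open>2\<close> makes \<open>h\<close> positive; hypothesis
  \<open>1\<close> lets the remaining mass \<open>x * \<beta>\<close> fit under a hypotenuse no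
  steeper than the tangent, so the upper bound is attained.\<close>

lemma qstar_eq:
  fixes a \<beta> \<eta> \<nu> x :: real
  assumes pos: "\<beta> > 0" "\<eta> > 0" "\<nu> > 0" and x: "0 < x" "x \<le> 1"
    and 1: "\<eta>\<^sup>2 \<le> 2 * \<nu> * \<beta>" and 2: "2 * \<nu> * ((1 - x) * \<beta>) < \<eta>\<^sup>2"
  shows "qstar a \<beta> \<eta> \<nu> (1 - x * \<beta>) = ereal (a + (\<eta> - sqrt (\<eta>\<^sup>2 - 2 * \<nu> * ((1 - x) * \<beta>))) / \<nu>)"
proof -
  define h where "h = sqrt (\<eta>\<^sup>2 - 2 * \<nu> * ((1 - x) * \<beta>))"
  define u where "u = (\<eta> - h) / \<nu>"
  \<comment> \<open>This slope gives the triangle of height \<open>h\<close> the area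
    \<open>x * \<beta>\<close>.\<close>
  define s where "s = h\<^sup>2 / (2 * (x * \<beta>))"
  have h: "h > 0" "h\<^sup>2 = \<eta>\<^sup>2 - 2 * \<nu> * ((1 - x) * \<beta>)" using 2 by (auto simp: h_def)
  have "h\<^sup>2 \<le> \<eta>\<^sup>2" using h x pos by simp
  then have "h \<le> \<eta>" using pos by (simp add: power2_le_iff_abs_le h(1))
  then have u: "0 \<le> u" "h = \<eta> - \<nu> * u" using pos by (auto simp: u_def)
  have "2 * \<nu> * (\<eta> * u - \<nu> * u\<^sup>2 / 2) = \<eta>\<^sup>2 - (\<eta> - \<nu> * u)\<^sup>2" by (simp add: algebra_simps power2_eq_square)
  also have "\<dots> = 2 * \<nu> * ((1 - x) * \<beta>)" using h(2) u(2) by simp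
  finally have "(1 - x) * \<beta> = \<eta> * u - \<nu> * u\<^sup>2 / 2" using pos by simp
  then have p: "(1 - x * \<beta>) - (1 - \<beta>) = \<eta> * u - \<nu> * u\<^sup>2 / 2" by (simp add: algebra_simps)
  have s: "s > 0" "1 - (1 - x * \<beta>) = h\<^sup>2 / (2 * s)" using h(1) x pos by (auto simp: s_def)
  have "h\<^sup>2 \<le> \<nu> * (2 * (x * \<beta>))" unfolding h(2) using 1 by (simp add: algebra_simps)
  then have "s \<le> \<nu>" using x pos by (simp add: s_def divide_le_eq)
  then have "\<exists>g. feasible a \<beta> \<eta> \<nu> (1 - x * \<beta>) (a + u) g"
    using feasible_piecewise_linear[OF p u h(1) s(1) _ s(2)] by blast
  moreover have "q' \<le> a + u" if "feasible a \<beta> \<eta> \<nu> (1 - x * \<beta>) q' g" for q' g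
    by (rule feasible_le[OF that pos(3) p u(1)]) (use h(1) u(2) in simp)
  ultimately have "qstar a \<beta> \<eta> \<nu> (1 - x * \<beta>) = ereal (a + u)"
    unfolding qstar_def by (intro Sup_eqI) auto
  then show ?thesis by (simp add: u_def h_def)
qed

section \<open>Quantiles and tail behaviour of the distribution function\<close>

text \<open>The intermediate value theorem yields \<open>y\<close> with \<open>F y = p\<close>.
  Strict growth just left of \<open>y\<close> makes it the least point of the superlevel set, so the
  infimum in \<open>quantile\<close> is a minimum.\<close>

lemma quantile_attained:
  fixes F :: "real \<Rightarrow> real"
  assumes F: "mono F" "(F \<longlongrightarrow> 1) at_top" and cont: "continuous_on {z<..} F" and strict: "strict_mono_on {z<..} F"
    and a: "z < a" and p: "F a \<le> p" "p < 1"
  shows "F (quantile F p) = p" and "a \<le> quantile F p"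
proof -
  have "\<forall>\<^sub>F b in at_top. p < F b" using order_tendstoD(1)[OF F(2) p(2)] .
  with eventually_ge_at_top[of a] have "\<forall>\<^sub>F b in at_top. a \<le> b \<and> p < F b" by eventually_elim simp
  then obtain b where b: "a \<le> b" "p < F b" using eventually_happens'[OF trivial_limit_at_top_linorder] by blast
  have "continuous_on {a..b} F" using cont a by (auto intro: continuous_on_subset)
  then obtain y where y: "a \<le> y" "F y = p" using IVT'[of F a p b] p b by auto
  have less: "F t < p" if "t < y" for t
  proof -
    \<comment> \<open>Strict growth is given beyond \<open>z\<close>, so the comparison of
      \<open>t\<close> with \<open>y\<close> passes through a point there.\<close>
    define m where "m = (max t z + y) / 2"
    have m: "t \<le> m" "z < m" "m < y" using that a y by (auto simp: m_def)
    have "F t \<le> F m" using m(1) by (rule monoD[OF F(1)])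
    also have "\<dots> < F y" using m a y by (intro strict_mono_onD[OF strict]) auto
    finally show ?thesis using y by simp
  qed
  have "{t. p \<le> F t} = {y..}"
    using less y monoD[OF F(1), of y] by (auto simp: not_le[symmetric]) 
  then have "quantile F p = y" by (simp add: quantile_def)
  then show "F (quantile F p) = p" "a \<le> quantile F p" using y by auto
qed

lemma MDA_imp_regularly_varying:
  assumes F: "cdf_with_density F f" and "MDA F xi" "xi > 0"
  shows "F y < 1"
    and "t > 0 \<Longrightarrow> ((\<lambda>a. (1 - F (a * t)) / (1 - F a)) \<longlongrightarrow> t powr (- (1 / xi))) at_top"
proof -
  obtain c d :: "nat \<Rightarrow> real" where c: "\<And>n. c n > 0" and
    lim: "\<And>s. s > 0 \<Longrightarrow> (\<lambda>n. real n * (1 - F (c n * s + d n))) \<longlonglongrightarrow> s powr (- (1 / xi))"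
    using MDA_imp_tail_limit[OF assms] by blast
  have G: "antimono (\<lambda>y. 1 - F y)" "((\<lambda>y. 1 - F y) \<longlongrightarrow> 0) at_top"
    using F tendsto_diff[OF tendsto_const[of 1], of F 1 at_top]
    by (auto simp: cdf_with_density_def monotone_def)
  have "1 / xi > 0" using assms by simp
  note rv = tail_regularly_varying[where c = c and d = d, OF G c this lim]
  show "F y < 1" using rv(1)[where y = y] by simp
  show "((\<lambda>a. (1 - F (a * t)) / (1 - F a)) \<longlongrightarrow> t powr (- (1 / xi))) at_top" if "t > 0"
    using rv(2)[where t = t] that by simp
qed

text \<open>As \<open>F\<close> stays below 1, the right endpoint is infinite and the interval of
  Assumption A1 becomes a half-line.\<close>

lemma A1_tail:
  assumes "assumption_A1 F f" and lt1: "\<And>y. F y < 1"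
  obtains z where "\<And>y. y > z \<Longrightarrow> (F has_real_derivative f y) (at y)"
    "\<And>y. y > z \<Longrightarrow> (f has_real_derivative deriv f y) (at y)"
    "\<And>y. y > z \<Longrightarrow> f y > 0"
    "\<And>u v. z < u \<Longrightarrow> u \<le> v \<Longrightarrow> f v \<le> f u"
    "convex_on {z<..} f"
proof -
  have inf: "ereal y < right_endpoint F" for y
  proof -
    have "ereal y < ereal (y + 1)" by simp
    also have "\<dots> \<le> right_endpoint F" unfolding right_endpoint_def using lt1 by (intro SUP_upper) auto
    finally show ?thesis .
  qed
  obtain z where z: "\<forall>y>z. (F has_real_derivative f y) (at y) \<and> f differentiable (at y) \<and> f y > 0"
    "\<forall>u>z. \<forall>v>z. u \<le> v \<longrightarrow> f v \<le> f u" "convex_on {z<..} f"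
    using assms(1) inf unfolding assumption_A1_def Let_def greaterThan_def by auto
  show ?thesis
    by (rule that[of z]) (use z in \<open>auto simp: DERIV_deriv_iff_real_differentiable\<close>)
qed

text \<open>By the mean value theorem the chord slope is a value of \<open>f\<close> between
  \<open>a\<close> and \<open>y\<close>. For \<open>1 - F\<close> this becomes the tangent
  inequality required by \<open>monotone_density\<close>.\<close>

lemma decreasing_derivative_imp_below_tangent:
  fixes F f :: "real \<Rightarrow> real"
  assumes deriv: "\<And>y. y > z \<Longrightarrow> (F has_real_derivative f y) (at y)"
    and decr: "\<And>u v. z < u \<Longrightarrow> u \<le> v \<Longrightarrow> f v \<le> f u"
    and a: "z < a" "z < y"
  shows "F y \<le> F a + f a * (y - a)"
proof (cases y a rule: linorder_cases)
  case less
  obtain m where "y < m" "m < a" "F a - F y = (a - y) * f m"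
    using MVT2[OF less, of F f] deriv a by auto
  moreover from this have "(a - y) * f a \<le> (a - y) * f m" using a by (intro mult_left_mono decr) auto
  ultimately show ?thesis by (simp add: algebra_simps)
next
  case greater
  obtain m where "a < m" "m < y" "F y - F a = (y - a) * f m"
    using MVT2[OF greater, of F f] deriv a by auto
  moreover from this have "(y - a) * f m \<le> (y - a) * f a" using a by (intro mult_left_mono decr) auto
  ultimately show ?thesis by (simp add: algebra_simps)
qed simp

section \<open>Limit of the ratio of the optimal value to the quantile\<close>

theorem theorem7:
  fixes F f :: "real \<Rightarrow> real" and xi x :: real
  assumes "cdf_with_density F f"
    and "assumption_A1 F f"
    and "MDA F xi" and "xi > 0"
    and "1 - 1 / (2 * (xi + 1)) < x" and "x \<le> 1"
  shows "((\<lambda>a. qstar a (1 - F a) (f a) (- deriv f a) (1 - x * (1 - F a))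
                 / ereal (quantile F (1 - x * (1 - F a))))
          \<longlongrightarrow> ereal (x powr xi * (xi / (xi + 1) * (1 - sqrt (1 - 2 * (1 - x) * (xi + 1))) + 1)))
          at_top"
proof -
  define \<alpha> where "\<alpha> = 1 / xi"
  have \<alpha>: "\<alpha> > 0" using \<open>xi > 0\<close> by (simp add: \<alpha>_def)
  define \<beta> \<nu> where "\<beta> a = 1 - F a" and "\<nu> a = - deriv f a" for a
  define q where "q a = quantile F (1 - x * \<beta> a)" for a
  note rv = MDA_imp_regularly_varying[OF assms(1,3,4), folded \<alpha>_def \<beta>_def]
  have \<beta>_pos: "\<beta> a > 0" for a using rv(1)[of a] by (simp add: \<beta>_def)
  have mono: "mono F" and F1: "(F \<longlongrightarrow> 1) at_top" using assms(1) by (auto simp: cdf_with_density_def)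
  obtain z where dF: "\<And>y. y > z \<Longrightarrow> (F has_real_derivative f y) (at y)"
    and df: "\<And>y. y > z \<Longrightarrow> (f has_real_derivative deriv f y) (at y)"
    and f_pos: "\<And>y. y > z \<Longrightarrow> f y > 0"
    and decr: "\<And>u v. z < u \<Longrightarrow> u \<le> v \<Longrightarrow> f v \<le> f u"
    and convex: "convex_on {z<..} f"
    using A1_tail[OF assms(2) rv(1)] by blast

  have lim1: "((\<lambda>a. a * f a / \<beta> a) \<longlongrightarrow> \<alpha>) at_top"
  proof (rule monotone_density[of z])
    show "\<beta> a - f a * (y - a) \<le> \<beta> y" if "z < a" "z < y" for a y
      using decreasing_derivative_imp_below_tangent[OF dF decr that] by (simp add: \<beta>_def)
  qed (use \<beta>_pos rv(2) in auto)
  \<comment> \<open>Convexity of \<open>f\<close> supplies the tangent inequality, and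
    \<open>lim1\<close> the regular variation of \<open>f\<close> with index
    \<open>- (\<alpha> + 1)\<close>.\<close>
  have lim2: "((\<lambda>a. a * \<nu> a / f a) \<longlongrightarrow> \<alpha> + 1) at_top"
  proof (rule monotone_density[of z])
    show "f a - \<nu> a * (y - a) \<le> f y" if "z < a" "z < y" for a y
    proof -
      have "deriv f a * (y - a) \<le> f y - f a"
        using that df[of a]
        by (intro convex_on_imp_above_tangent[OF convex])
          (auto simp: interior_open intro: has_field_derivative_at_within)
      then show ?thesis by (simp add: \<nu>_def algebra_simps)
    qed
    show "((\<lambda>a. f (a * t) / f a) \<longlongrightarrow> t powr (- (\<alpha> + 1))) at_top" if "t > 0" for t
      using density_regularly_varying[OF _ rv(2)[OF that] lim1 \<alpha> that] \<beta>_pos by blast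
  qed (rule f_pos)

  have half: "1 / (2 * (xi + 1)) < 1 / 2" using \<open>xi > 0\<close> by (simp add: field_simps)
  then have x: "0 < x" "x \<le> 1" using assms(5,6) by linarith+
  \<comment> \<open>The lower bound on \<open>x\<close> is exactly positivity of the limiting
    radicand.\<close>
  have "(1 - x) * (2 * (xi + 1)) < 1 / (2 * (xi + 1)) * (2 * (xi + 1))"
    using assms(4,5) by (intro mult_strict_right_mono) auto
  then have disc: "2 * (1 - x) * (xi + 1) < 1" using assms(4) by (simp add: algebra_simps)

  have \<alpha>_xi: "(\<alpha> + 1) / \<alpha> = xi + 1" "1 / (\<alpha> + 1) = xi / (xi + 1)"
    using assms(4) by (simp_all add: \<alpha>_def field_simps)
  \<comment> \<open>With this scale-free quantity the radicand in \<open>qstar_eq\<close> becomes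
    \<open>(f a)\<^sup>2 * (1 - 2 * (1 - x) * R a)\<close>; its limit is that of \<open>lim2\<close>
    divided by that of \<open>lim1\<close>.\<close>
  define R where "R a = \<nu> a * \<beta> a / (f a)\<^sup>2" for a
  have "((\<lambda>a. (a * \<nu> a / f a) / (a * f a / \<beta> a)) \<longlongrightarrow> (\<alpha> + 1) / \<alpha>) at_top"
    using \<alpha> by (intro tendsto_divide lim1 lim2) auto
  then have "((\<lambda>a. (a * \<nu> a / f a) / (a * f a / \<beta> a)) \<longlongrightarrow> xi + 1) at_top"
    using \<alpha>_xi by simp
  moreover have "\<forall>\<^sub>F a in at_top. (a * \<nu> a / f a) / (a * f a / \<beta> a) = R a"
    using eventually_gt_at_top[of 0]
  proof eventually_elim
    case (elim a)
    then show ?case using \<beta>_pos[of a] by (simp add: R_def field_simps power2_eq_square)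
  qed
  ultimately have R: "(R \<longlongrightarrow> xi + 1) at_top" by (rule Lim_transform_eventually)

  have quant: "F (q a) = 1 - x * \<beta> a" "a \<le> q a" if "z < a" for a
  proof -
    have cont: "continuous_on {z<..} F"
      using dF DERIV_isCont by (intro continuous_at_imp_continuous_on) blast
    have strict: "strict_mono_on {z<..} F"
    proof (rule strict_mono_onI)
      fix u v assume uv: "u \<in> {z<..}" "u < v"
      show "F u < F v"
      proof (rule DERIV_pos_imp_increasing[OF uv(2)])
        fix t assume "u \<le> t"
        then have "z < t" using uv by simp
        then show "\<exists>D. (F has_real_derivative D) (at t) \<and> D > 0" using dF f_pos by blast
      qed
    qed
    have "x * \<beta> a \<le> 1 * \<beta> a" using x \<beta>_pos[of a] by (intro mult_right_mono) auto
    then have "F a \<le> 1 - x * \<beta> a" by (simp add: \<beta>_def)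
    moreover have "1 - x * \<beta> a < 1" using x \<beta>_pos by simp
    ultimately show "F (q a) = 1 - x * \<beta> a" "a \<le> q a"
      unfolding q_def using quantile_attained[OF mono F1 cont strict that] by auto
  qed
  \<comment> \<open>For large \<open>a\<close> the ratio \<open>\<beta> (q a) / \<beta> a\<close> is
    exactly \<open>x\<close>, so inverting regular variation gives the solution of
    \<open>s powr (- \<alpha>) = x\<close> as limit.\<close>
  have q_lim: "((\<lambda>a. q a / a) \<longlongrightarrow> x powr (- xi)) at_top"
  proof (rule antimono_powr_limit_inverse[where h = "\<lambda>a s. \<beta> (a * s) / \<beta> a" and \<alpha> = \<alpha>])
    have anti: "antimono \<beta>" using mono by (simp add: \<beta>_def monotone_def)
    show "\<forall>\<^sub>F a in at_top. antimono (\<lambda>s. \<beta> (a * s) / \<beta> a)"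
      using eventually_ge_at_top[of 0]
    proof eventually_elim
      case (elim a)
      then show ?case
        using antimono_scaled_affine[OF anti, of "1 / \<beta> a" a 0] \<beta>_pos[of a] by simp
    qed
    have "\<forall>\<^sub>F a in at_top. x = \<beta> (a * (q a / a)) / \<beta> a"
      using eventually_gt_at_top[of 0] eventually_gt_at_top[of z]
    proof eventually_elim
      case (elim a)
      then have "\<beta> (q a) = x * \<beta> a" using quant(1) by (simp add: \<beta>_def)
      then show ?case using elim \<beta>_pos[of a] by simp
    qed
    then have "((\<lambda>a. \<beta> (a * (q a / a)) / \<beta> a) \<longlongrightarrow> x) at_top"
      by (rule Lim_transform_eventually[OF tendsto_const])
    moreover have "(x powr (- xi)) powr (- \<alpha>) = x"
      using x assms(4) by (simp add: powr_powr \<alpha>_def)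
    ultimately show "((\<lambda>a. \<beta> (a * (q a / a)) / \<beta> a) \<longlongrightarrow> (x powr (- xi)) powr (- \<alpha>)) at_top" by simp
  qed (use x \<alpha> rv(2) in auto)

  \<comment> \<open>For large \<open>a\<close> this is the optimal value divided by
    \<open>a\<close>, minus 1.\<close>
  define w where "w a = 1 / (a * \<nu> a / f a) * (1 - sqrt (1 - 2 * (1 - x) * R a))" for a
  have w_lim: "(w \<longlongrightarrow> 1 / (\<alpha> + 1) * (1 - sqrt (1 - 2 * (1 - x) * (xi + 1)))) at_top"
    unfolding w_def using \<alpha> by (intro tendsto_intros lim2 R) auto

  have "((\<lambda>a. (1 + w a) / (q a / a)) \<longlongrightarrow>
      (1 + 1 / (\<alpha> + 1) * (1 - sqrt (1 - 2 * (1 - x) * (xi + 1)))) / x powr (- xi)) at_top"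
    using x by (intro tendsto_divide[OF _ q_lim] tendsto_add w_lim tendsto_const) auto
  then have lim: "((\<lambda>a. ereal ((1 + w a) / (q a / a))) \<longlongrightarrow>
      ereal (x powr xi * (xi / (xi + 1) * (1 - sqrt (1 - 2 * (1 - x) * (xi + 1))) + 1))) at_top"
    using x unfolding \<alpha>_xi by (simp add: powr_minus divide_simps mult.commute add.commute)

  \<comment> \<open>The two eventual bounds on \<open>R\<close> are, after scaling by
    \<open>(f a)\<^sup>2\<close>, the hypotheses \<open>1\<close> and \<open>2\<close> of
    \<open>qstar_eq\<close>.\<close>
  have "\<forall>\<^sub>F a in at_top. 1 / 2 < R a"
    by (rule order_tendstoD(1)[OF R]) (use assms(4) in simp)
  moreover have "((\<lambda>a. 2 * (1 - x) * R a) \<longlongrightarrow> 2 * (1 - x) * (xi + 1)) at_top"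
    by (intro tendsto_mult tendsto_const R)
  then have "\<forall>\<^sub>F a in at_top. 2 * (1 - x) * R a < 1" using order_tendstoD(2) disc by blast
  ultimately have "\<forall>\<^sub>F a in at_top. ereal ((1 + w a) / (q a / a)) =
      qstar a (1 - F a) (f a) (- deriv f a) (1 - x * (1 - F a)) / ereal (quantile F (1 - x * (1 - F a)))"
    using eventually_gt_at_top[of z] eventually_gt_at_top[of 0]
  proof eventually_elim
    case (elim a)
    have f: "f a > 0" using f_pos elim by simp
    then have \<nu>\<beta>: "\<nu> a * \<beta> a = R a * (f a)\<^sup>2" by (simp add: R_def)
    \<comment> \<open>Monotonicity of \<open>f\<close> alone gives \<open>\<nu> a \<ge> 0\<close>;
      strict positivity comes from that of \<open>R a\<close>.\<close>
    have "0 < R a * (f a)\<^sup>2" using elim f by (intro mult_pos_pos) auto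
    then have \<nu>: "\<nu> a > 0" using \<nu>\<beta> \<beta>_pos[of a] by (metis zero_less_mult_pos2)
    have "2 * \<nu> a * ((1 - x) * \<beta> a) = 2 * (1 - x) * (\<nu> a * \<beta> a)" by (simp only: mult_ac)
    then have eq: "2 * \<nu> a * ((1 - x) * \<beta> a) = 2 * (1 - x) * R a * (f a)\<^sup>2"
      unfolding \<nu>\<beta> by (simp only: mult_ac)
    have "(1 / 2) * (f a)\<^sup>2 \<le> R a * (f a)\<^sup>2" using elim by (intro mult_right_mono) auto
    then have 1: "(f a)\<^sup>2 \<le> 2 * \<nu> a * \<beta> a" using \<nu>\<beta> by simp
    have "2 * (1 - x) * R a * (f a)\<^sup>2 < 1 * (f a)\<^sup>2" using elim f by (intro mult_strict_right_mono) auto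
    then have 2: "2 * \<nu> a * ((1 - x) * \<beta> a) < (f a)\<^sup>2" using eq by simp
    have "(f a)\<^sup>2 - 2 * \<nu> a * ((1 - x) * \<beta> a) = (f a)\<^sup>2 * (1 - 2 * (1 - x) * R a)"
      unfolding eq by (simp add: algebra_simps)
    then have "sqrt ((f a)\<^sup>2 - 2 * \<nu> a * ((1 - x) * \<beta> a)) = f a * sqrt (1 - 2 * (1 - x) * R a)"
      using f by (simp add: real_sqrt_mult)
    then have "a + (f a - sqrt ((f a)\<^sup>2 - 2 * \<nu> a * ((1 - x) * \<beta> a))) / \<nu> a = a * (1 + w a)"
      using elim f \<nu> by (simp add: w_def field_simps)
    then have "qstar a (\<beta> a) (f a) (\<nu> a) (1 - x * \<beta> a) = ereal (a * (1 + w a))"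
      using qstar_eq[OF \<beta>_pos f \<nu> x 1 2] by simp
    moreover have "q a > 0" using quant(2)[of a] elim by simp
    ultimately have "qstar a (\<beta> a) (f a) (\<nu> a) (1 - x * \<beta> a) / ereal (q a) = ereal ((1 + w a) / (q a / a))"
      using elim by (simp add: field_simps)
    then show ?case by (simp add: q_def \<beta>_def \<nu>_def)
  qed
  with lim show ?thesis by (rule Lim_transform_eventually)
qed

end
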